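(* Let $a\ge 1$ and $b\ge 3$ be integers. The graph $K_a *_\psi (K_b *_\phi G_8)$ has order $8ab$ and maximum degree $4a+b-2$; its diameter is the smallest among all graphs of order $8ab$ and maximum degree $4a+b-2$, and its average shortest path length is the smallest among all graphs of order $8ab$ and maximum degree $4a+b-2$. In particular, for $a=4$ and $b=8$, the graph $K_4 *_\psi (K_8 *_\phi G_8)$ has order $256$, degree $22$ and diameter $2$, and its average shortest path length is the smallest among all graphs of order $256$ and degree $22$.
   Context: All graphs are finite, simple and undirected; $u\sim v$ means $u$ and $v$ are adjacent. The order of $G$ is $|V(G)|$; the degree of a graph means the maximum degree of its vertices. The distance $d(u,v)$ is the length of a shortest path from $u$ to $v$ (infinite if there is none), the diameter of $G$ is $D(G)=\max_{u,v\in V(G)} d(u,v)$, and the average shortest path length of $G$ with vertex set $V$ is \[ ASPL(G)=\frac{\sum_{u,v\in V} d(u,v)}{|V|(|V|-1)} .\] $K_n$ is the complete graph with vertex set $\{0,1,\ldots,n-1\}$. The graph $G_8$: its vertex set is $V(G_8)=\{(0,0),(0,1),(1,0),(1,1),(1,2),(2,0),(2,1),(2,2)\}$. Two distinct vertices $(i,j)$ and $(k,l)$ are adjacent if and only if either $(i,k)\in\{(0,1),(1,0),(2,2)\}$, or $(i,k)\in\{(1,2),(2,1)\}$ and $j=l$. Star product: let $G_1,G_2$ be graphs, fix an orientation of all edges of $G_1$, and let $\vec E$ be the resulting set of arrows. For each $(u,w)\in\vec E$ let $\phi(u,w)$ be a bijection of $V(G_2)$. The graph $G_1 *_\phi G_2$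 has vertex set $V(G_1)\times V(G_2)$, and $(u,v)$ is adjacent to $(w,x)$ (adjacency being taken symmetrically) if and only if either $u=w$ and $(v,x)$ is an edge of $G_2$, or $(u,w)\in\vec E$ and $x=\phi(u,w)(v)$. $m$-multiple star product: with $G_1,G_2,\vec E$ as in the previous paragraph, for each $(u,w)\in\vec E$ and $l\in\{0,\ldots,m-1\}$ let $\psi(u,w,l)$ be a bijection of $V(G_2)$. The graph $G_1 *_\psi G_2$ has vertex set $V(G_1)\times V(G_2)$, and $(u,v)$ is adjacent to $(w,x)$ (taken symmetrically) if and only if either $u=w$ and $(v,x)$ is an edge of $G_2$, or $(u,w)\in\vec E$ and $x=\psi(u,w,l)(v)$ for some $l\in\{0,\ldots,m-1\}$. The graph $K_b *_\phi G_8$: the star product with $\vec E=\{(k_1,k_2): k_1<k_2\}$ and, for every $k_1<k_2$, \[ \phi(k_1,k_2)((i,j))=\begin{cases}(0,1-j) & i=0\\ (2,\,j+1 \bmod 3) & i=1\\ (1,\,j-1 \bmod 3) & i=2.\end{cases}\] The graph $K_a *_\psi (K_b *_\phi G_8)$: the $4$-multiple star product with $G_1=K_a$, $G_2=K_b *_\phi G_8$, $\vec E=\{(l_1,l_2): l_1<l_2\}$ and, for all $l_1<l_2$, $n\in\{0,1,2,3\}$, $k\in V(K_b)$ and $(i,j)\in V(G_8)$, $\psi(l_1,l_2,n)((k,(i,j)))=(k,\sigma_n(i,j))$, where $\sigma_0,\sigma_1,\sigma_2,\sigma_3$ are the following permutations of $V(G_8)$: $\sigma_0$: $(0,0)\mapsto(0,0)$,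 $(1,0)\mapsto(0,1)$, $(1,1)\mapsto(1,0)$, $(1,2)\mapsto(2,1)$, $(0,1)\mapsto(1,1)$, $(2,0)\mapsto(2,2)$, $(2,1)\mapsto(1,2)$, $(2,2)\mapsto(2,0)$. $\sigma_1$: $(0,0)\mapsto(0,1)$, $(1,0)\mapsto(1,0)$, $(1,1)\mapsto(2,1)$, $(1,2)\mapsto(0,0)$, $(0,1)\mapsto(2,2)$, $(2,0)\mapsto(1,2)$, $(2,1)\mapsto(2,0)$, $(2,2)\mapsto(1,1)$. $\sigma_2$: $(0,0)\mapsto(1,0)$, $(1,0)\mapsto(2,1)$, $(1,1)\mapsto(0,0)$, $(1,2)\mapsto(0,1)$, $(0,1)\mapsto(1,2)$, $(2,0)\mapsto(2,0)$, $(2,1)\mapsto(1,1)$, $(2,2)\mapsto(2,2)$. $\sigma_3$: $(0,0)\mapsto(2,1)$, $(1,0)\mapsto(0,0)$, $(1,1)\mapsto(0,1)$, $(1,2)\mapsto(1,0)$, $(0,1)\mapsto(2,0)$, $(2,0)\mapsto(1,1)$, $(2,1)\mapsto(2,2)$, $(2,2)\mapsto(1,2)$. *)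

theory Defs
  imports
    "Graph_Theory.Pair_Digraph"
    "Graph_Theory.Shortest_Path"
begin

(* Finite simple undirected graphs are the objects satisfying the library predicate
   pair_graph: finite, loopless, and with a symmetric arc set, so that an undirected edge
   {u,v} is the pair of arcs (u,v), (v,u) and out_degree is the usual degree. *)

section \<open>Graph parameters\<close>

definition graph_order :: "'a pair_pre_digraph \<Rightarrow> nat" where
  "graph_order G = card (pverts G)"

definition max_degree :: "'a pair_pre_digraph \<Rightarrow> nat" where
  "max_degree G = Max (out_degree (with_proj G) ` pverts G)"

(* Infinite when there is no path. *)
definition gdist :: "'a pair_pre_digraph \<Rightarrow> 'a \<Rightarrow> 'a \<Rightarrow> ereal" where
  "gdist G u v = wf_digraph.\<mu> (with_proj G) (\<lambda>_. 1) u v"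

definition graph_diameter :: "'a pair_pre_digraph \<Rightarrow> ereal" where
  "graph_diameter G = Max ((\<lambda>(u, v). gdist G u v) ` (pverts G \<times> pverts G))"

definition ASPL :: "'a pair_pre_digraph \<Rightarrow> ereal" where
  "ASPL G = (\<Sum>u\<in>pverts G. \<Sum>v\<in>pverts G. gdist G u v)
     / ereal (real (card (pverts G)) * (real (card (pverts G)) - 1))"


section \<open>Star products\<close>

definition orientation :: "'a pair_pre_digraph \<Rightarrow> ('a \<times> 'a) set \<Rightarrow> bool" where
  "orientation G E \<longleftrightarrow> E \<subseteq> parcs G \<and>
     (\<forall>u v. (u, v) \<in> parcs G \<longrightarrow> ((u, v) \<in> E) \<noteq> ((v, u) \<in> E))"

(* Both products are meant for E an orientation of G1 and for maps that are bijections of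
   pverts G2 on every arc of E; the lemmas at the end of this theory establish this for the
   instances used. *)

definition star_product ::
  "'a pair_pre_digraph \<Rightarrow> ('a \<times> 'a) set \<Rightarrow> ('a \<Rightarrow> 'a \<Rightarrow> 'b \<Rightarrow> 'b) \<Rightarrow> 'b pair_pre_digraph
    \<Rightarrow> ('a \<times> 'b) pair_pre_digraph" where
  "star_product G1 E \<phi> G2 =
     \<lparr> pverts = pverts G1 \<times> pverts G2,
       parcs = {((u, v), (w, x)).
         u \<in> pverts G1 \<and> w \<in> pverts G1 \<and> v \<in> pverts G2 \<and> x \<in> pverts G2 \<and>
         (u = w \<and> (v, x) \<in> parcs G2
          \<or> (u, w) \<in> E \<and> x = \<phi> u w v
          \<or> (w, u) \<in> E \<and> v = \<phi> w u x)} \<rparr>"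

definition multi_star_product ::
  "nat \<Rightarrow> 'a pair_pre_digraph \<Rightarrow> ('a \<times> 'a) set \<Rightarrow> ('a \<Rightarrow> 'a \<Rightarrow> nat \<Rightarrow> 'b \<Rightarrow> 'b)
    \<Rightarrow> 'b pair_pre_digraph \<Rightarrow> ('a \<times> 'b) pair_pre_digraph" where
  "multi_star_product m G1 E \<psi> G2 =
     \<lparr> pverts = pverts G1 \<times> pverts G2,
       parcs = {((u, v), (w, x)).
         u \<in> pverts G1 \<and> w \<in> pverts G1 \<and> v \<in> pverts G2 \<and> x \<in> pverts G2 \<and>
         (u = w \<and> (v, x) \<in> parcs G2
          \<or> (\<exists>l<m. (u, w) \<in> E \<and> x = \<psi> u w l v)
          \<or> (\<exists>l<m. (w, u) \<in> E \<and> v = \<psi> w u l x))} \<rparr>"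


section \<open>The graphs of the construction\<close>

definition K :: "nat \<Rightarrow> nat pair_pre_digraph" where
  "K n = \<lparr> pverts = {0..<n},
           parcs = {(u, v). u \<in> {0..<n} \<and> v \<in> {0..<n} \<and> u \<noteq> v} \<rparr>"

definition K_arrows :: "nat \<Rightarrow> (nat \<times> nat) set" where
  "K_arrows n = {(k1, k2). k1 \<in> {0..<n} \<and> k2 \<in> {0..<n} \<and> k1 < k2}"

definition V8 :: "(int \<times> int) set" where
  "V8 = {(0,0), (0,1), (1,0), (1,1), (1,2), (2,0), (2,1), (2,2)}"

definition G8 :: "(int \<times> int) pair_pre_digraph" where
  "G8 = \<lparr> pverts = V8,
          parcs = {((i, j), (k, l)). (i, j) \<in> V8 \<and> (k, l) \<in> V8 \<and> (i, j) \<noteq> (k, l) \<and>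
            ((i, k) \<in> {(0,1), (1,0), (2,2)} \<or> (i, k) \<in> {(1,2), (2,1)} \<and> j = l)} \<rparr>"

fun phi8 :: "int \<times> int \<Rightarrow> int \<times> int" where
  "phi8 (i, j) =
     (if i = 0 then (0, 1 - j)
      else if i = 1 then (2, (j + 1) mod 3)
      else (1, (j - 1) mod 3))"

definition Kb_G8 :: "nat \<Rightarrow> (nat \<times> int \<times> int) pair_pre_digraph" where
  "Kb_G8 b = star_product (K b) (K_arrows b) (\<lambda>k1 k2. phi8) G8"

definition sigma_tables :: "((int \<times> int) \<times> (int \<times> int)) list list" where
  "sigma_tables =
    [[((0,0),(0,0)), ((1,0),(0,1)), ((1,1),(1,0)), ((1,2),(2,1)),
      ((0,1),(1,1)), ((2,0),(2,2)), ((2,1),(1,2)), ((2,2),(2,0))],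
     [((0,0),(0,1)), ((1,0),(1,0)), ((1,1),(2,1)), ((1,2),(0,0)),
      ((0,1),(2,2)), ((2,0),(1,2)), ((2,1),(2,0)), ((2,2),(1,1))],
     [((0,0),(1,0)), ((1,0),(2,1)), ((1,1),(0,0)), ((1,2),(0,1)),
      ((0,1),(1,2)), ((2,0),(2,0)), ((2,1),(1,1)), ((2,2),(2,2))],
     [((0,0),(2,1)), ((1,0),(0,0)), ((1,1),(0,1)), ((1,2),(1,0)),
      ((0,1),(2,0)), ((2,0),(1,1)), ((2,1),(2,2)), ((2,2),(1,2))]]"

definition sigma :: "nat \<Rightarrow> int \<times> int \<Rightarrow> int \<times> int" where
  "sigma n v = the (map_of (sigma_tables ! n) v)"

definition Ka_Kb_G8 :: "nat \<Rightarrow> nat \<Rightarrow> (nat \<times> nat \<times> int \<times> int) pair_pre_digraph" where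
  "Ka_Kb_G8 a b =
     multi_star_product 4 (K a) (K_arrows a) (\<lambda>l1 l2 n (k, v). (k, sigma n v)) (Kb_G8 b)"


section \<open>The constructions are legitimate star products\<close>

lemma orientation_K_arrows: "orientation (K n) (K_arrows n)"
  by (auto simp: orientation_def K_def K_arrows_def)

lemma bij_betw_phi8: "bij_betw phi8 (pverts G8) (pverts G8)"
  by (auto simp: bij_betw_def inj_on_def G8_def V8_def)

lemma bij_betw_sigma:
  assumes "n < 4"
  shows "bij_betw (sigma n) (pverts G8) (pverts G8)"
proof -
  from assms have "n = 0 \<or> n = 1 \<or> n = 2 \<or> n = 3" by auto
  then show ?thesis
    by (elim disjE) (auto simp: bij_betw_def inj_on_def G8_def V8_def sigma_def sigma_tables_def)
qed

lemma bij_betw_psi: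
  assumes "n < 4"
  shows "bij_betw (\<lambda>(k, v). (k, sigma n v)) (pverts (Kb_G8 b)) (pverts (Kb_G8 b))"
proof -
  have "bij_betw (map_prod id (sigma n)) (pverts (K b) \<times> pverts G8) (pverts (K b) \<times> pverts G8)"
    by (intro bij_betw_map_prod bij_betw_id bij_betw_sigma assms)
  moreover have "map_prod id (sigma n) = (\<lambda>(k :: nat, v). (k, sigma n v))"
    by auto
  ultimately show ?thesis
    by (simp add: Kb_G8_def star_product_def)
qed

end

theory Submission
  imports Defs
begin

text \<open>
  A vertex of degree at most \<open>d\<close> in a graph on \<open>n\<close> vertices has at most \<open>d\<close> vertices at distance 1,
  and all the remaining ones are at distance at least 2.  Hence the distances from one vertex add up
  to at least \<open>2 (n - 1) - d\<close>, and equality holds for every vertex if the graph is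
  \<open>d\<close>-regular of diameter at most 2.  So a \<open>d\<close>-regular graph of diameter 2 has the least average
  shortest path length among all graphs with its order and maximum degree
  (lemma \<open>ASPL_le_of_regular_diameter_2\<close>).  Its diameter is the least as well, since diameter at most
  1 would force the degree \<open>n - 1\<close> (lemma \<open>graph_diameter_ge_2\<close>).

  It remains to see that \<open>Ka_Kb_G8 a b\<close> is regular of degree \<open>4a + b - 2\<close> and has diameter 2.
  Regularity comes from a degree formula for star products (lemma \<open>out_degree_multi_star_product\<close>):
  an edge of the first factor contributes \<open>m\<close> to the degree as soon as the \<open>m\<close> bijections on it
  take \<open>m\<close> different values at each point, which the four permutations \<open>sigma n\<close> do.  With
  \<open>G8\<close> being 3-regular the degree is \<open>4 (a - 1) + (b - 1) + 3\<close>.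

  For the diameter, write the vertices as \<open>(l, k, v)\<close> with \<open>l\<close> in \<open>K a\<close>, \<open>k\<close> in \<open>K b\<close> and \<open>v\<close> in
  \<open>G8\<close>.  Because \<open>phi8\<close> is an involution, it does not matter which of \<open>k, k'\<close> is the smaller one;
  and since paths can be reversed, \<open>l \<le> l'\<close> may be assumed.  This leaves four cases, according to
  which of the two outer coordinates agree, and each of them reduces to a property of the eight
  vertices of \<open>G8\<close> alone, which is checked by inspection (the lemmas \<open>G8_diameter_2\<close>,
  \<open>phi8_covers_V8\<close>, \<open>sigma_covers_V8\<close> and \<open>phi8_sigma_cover_V8\<close>).  The hypothesis \<open>b \<ge> 3\<close> is
  used for the vertices \<open>(l, k, v)\<close> and \<open>(l, k', v)\<close> with \<open>k \<noteq> k'\<close>: they are joined by applying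
  \<open>phi8\<close> twice, through a third copy of \<open>G8\<close>.
\<close>

section \<open>The extremal bound for graphs of diameter two\<close>

lemma out_degree_eq_card_neighbours:
  "out_degree (with_proj G) u = card (parcs G `` {u})"
proof -
  have "out_arcs (with_proj G) u = Pair u ` (parcs G `` {u})"
    by (auto simp: out_arcs_def)
  then show ?thesis
    by (simp add: out_degree_def card_image inj_on_def)
qed

lemma out_degree_le_max_degree:
  assumes "pair_graph G" "u \<in> pverts G"
  shows "out_degree (with_proj G) u \<le> max_degree G"
proof -
  interpret pair_graph G by fact
  show ?thesis
    using assms(2) unfolding max_degree_def by (intro Max_ge) auto
qed

lemma pair_graph_arcs_sym:
  assumes "pair_graph G" "(u, v) \<in> parcs G"
  shows "(v, u) \<in> parcs G"
proof -
  interpret pair_graph G by fact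
  show ?thesis using assms(2) pair_sym_arcs by (auto simp: symmetric_def dest: symD)
qed

lemma max_degree_regular:
  assumes "pverts G \<noteq> {}" "\<And>u. u \<in> pverts G \<Longrightarrow> out_degree (with_proj G) u = d"
  shows "max_degree G = d"
proof -
  have "out_degree (with_proj G) ` pverts G = {d}" using assms by auto
  then show ?thesis by (simp add: max_degree_def)
qed

text \<open>The distance truncated at 2; it is determined by adjacency alone.\<close>

definition truncated_dist :: "'a pair_pre_digraph \<Rightarrow> 'a \<Rightarrow> 'a \<Rightarrow> real" where
  "truncated_dist G u v = (if u = v then 0 else if (u, v) \<in> parcs G then 1 else 2)"

lemma gdist_ge_truncated_dist:
  assumes "pair_graph G"
  shows "ereal (truncated_dist G u v) \<le> gdist G u v"
proof -
  interpret pair_graph G by fact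
  have "truncated_dist G u v \<le> awalk_cost (\<lambda>_. 1) p" if "awalk u p v" for p
  proof (cases p)
    case Nil
    with that have "u = v" by (simp add: awalk_Nil_iff)
    with Nil show ?thesis by (simp add: truncated_dist_def)
  next
    case p: (Cons e es)
    show ?thesis
    proof (cases es)
      case Nil
      with that p have "(u, v) \<in> parcs G"
        by (cases e) (simp add: awalk_Cons_iff awalk_Nil_iff)
      with p Nil show ?thesis by (simp add: truncated_dist_def)
    next
      case (Cons e' es')
      have "0 \<le> awalk_cost (\<lambda>_. 1) es'" by (induction es') auto
      with p Cons show ?thesis by (simp add: truncated_dist_def)
    qed
  qed
  then show ?thesis
    unfolding gdist_def \<mu>_def by (intro INF_greatest) auto
qed

lemma gdist_le_1:
  assumes "pair_graph G" "(u, v) \<in> parcs G"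
  shows "gdist G u v \<le> 1"
proof -
  interpret pair_graph G by fact
  have "awalk u [(u, v)] v"
    using assms(2) by (auto simp: awalk_Cons_iff awalk_Nil_iff dest: in_arcsD1 in_arcsD2)
  from min_cost_le_walk_cost[OF this, of "\<lambda>_. 1"] show ?thesis
    by (simp add: gdist_def one_ereal_def)
qed

lemma gdist_le_2:
  assumes "pair_graph G" "(u, w) \<in> parcs G" "(w, v) \<in> parcs G"
  shows "gdist G u v \<le> 2"
proof -
  interpret pair_graph G by fact
  have "awalk u [(u, w), (w, v)] v"
    using assms(2,3) by (auto simp: awalk_Cons_iff awalk_Nil_iff dest: in_arcsD1 in_arcsD2)
  from min_cost_le_walk_cost[OF this, of "\<lambda>_. 1"] show ?thesis
    by (simp add: gdist_def)
qed

lemma gdist_self: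
  assumes "pair_graph G" "u \<in> pverts G"
  shows "gdist G u u = 0"
proof (rule antisym)
  interpret pair_graph G by fact
  have "awalk u [] u" using assms(2) by (simp add: awalk_Nil_iff)
  from min_cost_le_walk_cost[OF this, of "\<lambda>_. 1"] show "gdist G u u \<le> 0"
    by (simp add: gdist_def zero_ereal_def)
  show "0 \<le> gdist G u u"
    using gdist_ge_truncated_dist[OF assms(1), of u u]
    by (simp add: truncated_dist_def zero_ereal_def)
qed

lemma gdist_eq_truncated_dist:
  assumes "pair_graph G" "u \<in> pverts G" "gdist G u v \<le> 2"
  shows "gdist G u v = ereal (truncated_dist G u v)"
proof (rule antisym[OF _ gdist_ge_truncated_dist[OF assms(1)]])
  show "gdist G u v \<le> ereal (truncated_dist G u v)"
    using assms gdist_self[OF assms(1,2)] gdist_le_1[OF assms(1), of u v]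
    by (auto simp: truncated_dist_def one_ereal_def zero_ereal_def)
qed

text \<open>
  Replacing every distance by the constant 2 overcounts by 2 at \<open>u\<close> itself and by 1 at each neighbour of \<open>u\<close>.
\<close>

lemma sum_truncated_dist:
  assumes "pair_graph G" "u \<in> pverts G"
  shows "(\<Sum>v\<in>pverts G. truncated_dist G u v)
    = 2 * (real (graph_order G) - 1) - real (out_degree (with_proj G) u)"
proof -
  interpret pair_graph G by fact
  have nbrs: "parcs G `` {u} \<subseteq> pverts G" by (auto dest: in_arcsD2)
  have "(\<Sum>v\<in>pverts G. truncated_dist G u v)
    = (\<Sum>v\<in>pverts G. 2 - (if v = u then 2 else 0) - (if v \<in> parcs G `` {u} then 1 else 0))"
    by (intro sum.cong refl) (auto simp: truncated_dist_def dest: no_loops')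
  also have "\<dots> = 2 * real (card (pverts G)) - 2 - real (card (pverts G \<inter> parcs G `` {u}))"
    using assms(2) pair_finite_verts
    by (simp add: sum_subtractf sum.If_cases Int_def del: Image_singleton_iff)
  also have "pverts G \<inter> parcs G `` {u} = parcs G `` {u}" using nbrs by auto
  finally show ?thesis
    by (simp add: graph_order_def out_degree_eq_card_neighbours)
qed

lemma ASPL_le_of_regular_diameter_2:
  assumes G: "pair_graph G" and H: "pair_graph H"
    and order: "graph_order H = graph_order G" and size: "2 \<le> graph_order G"
    and regular: "\<And>u. u \<in> pverts G \<Longrightarrow> out_degree (with_proj G) u = d"
    and diam: "\<And>u v. u \<in> pverts G \<Longrightarrow> v \<in> pverts G \<Longrightarrow> gdist G u v \<le> 2"
    and deg: "max_degree H \<le> d"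
  shows "ASPL G \<le> ASPL H"
proof -
  let ?n = "graph_order G"
  have "(\<Sum>u\<in>pverts G. \<Sum>v\<in>pverts G. gdist G u v)
      = (\<Sum>u\<in>pverts G. \<Sum>v\<in>pverts G. ereal (truncated_dist G u v))"
    by (intro sum.cong refl gdist_eq_truncated_dist G diam)
  also have "\<dots> = ereal (\<Sum>u\<in>pverts G. 2 * (real ?n - 1) - real d)"
    by (simp add: sum_truncated_dist[OF G] regular cong: sum.cong)
  also have "\<dots> = ereal (real ?n * (2 * (real ?n - 1) - real d))"
    by (simp add: graph_order_def)
  also have "\<dots> = ereal (\<Sum>u\<in>pverts H. 2 * (real ?n - 1) - real d)"
    by (simp add: order[unfolded graph_order_def] graph_order_def)
  also have "\<dots> \<le> ereal (\<Sum>u\<in>pverts H. \<Sum>v\<in>pverts H. truncated_dist H u v)"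
  proof -
    have "2 * (real ?n - 1) - real d \<le> (\<Sum>v\<in>pverts H. truncated_dist H u v)"
      if "u \<in> pverts H" for u
      using out_degree_le_max_degree[OF H that] deg
      by (simp add: sum_truncated_dist[OF H that] order)
    then have "(\<Sum>u\<in>pverts H. 2 * (real ?n - 1) - real d)
      \<le> (\<Sum>u\<in>pverts H. \<Sum>v\<in>pverts H. truncated_dist H u v)"
      by (rule sum_mono)
    then show ?thesis by (simp only: ereal_less_eq)
  qed
  also have "\<dots> = (\<Sum>u\<in>pverts H. \<Sum>v\<in>pverts H. ereal (truncated_dist H u v))"
    by simp
  also have "\<dots> \<le> (\<Sum>u\<in>pverts H. \<Sum>v\<in>pverts H. gdist H u v)"
    by (intro sum_mono gdist_ge_truncated_dist H)
  finally have sums: "(\<Sum>u\<in>pverts G. \<Sum>v\<in>pverts G. gdist G u v)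
    \<le> (\<Sum>u\<in>pverts H. \<Sum>v\<in>pverts H. gdist H u v)" .
  have card: "card (pverts H) = card (pverts G)"
    using order by (simp add: graph_order_def)
  have "0 < real (card (pverts G)) * (real (card (pverts G)) - 1)"
    using size by (simp add: graph_order_def)
  then show ?thesis
    using sums unfolding ASPL_def card by (intro ereal_divide_right_mono) auto
qed

lemma graph_diameter_ge_2:
  assumes "pair_graph H" "max_degree H + 1 < graph_order H"
  shows "2 \<le> graph_diameter H"
proof -
  interpret pair_graph H by fact
  from assms(2) have "pverts H \<noteq> {}" by (auto simp: graph_order_def)
  then obtain u where u: "u \<in> pverts H" by auto
  have "card (insert u (parcs H `` {u})) \<le> Suc (card (parcs H `` {u}))"
    by (rule card_insert_le_m1) auto
  also have "\<dots> < card (pverts H)"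
    using out_degree_le_max_degree[OF assms(1) u] assms(2)
    by (simp add: out_degree_eq_card_neighbours graph_order_def)
  finally have "\<not> pverts H \<subseteq> insert u (parcs H `` {u})"
    using card_mono[of "insert u (parcs H `` {u})" "pverts H"] pair_finite_arcs
    by (auto simp: finite_Image)
  then obtain v where v: "v \<in> pverts H" "v \<noteq> u" "(u, v) \<notin> parcs H" by auto
  then have "2 \<le> gdist H u v"
    using gdist_ge_truncated_dist[OF assms(1), of u v] by (simp add: truncated_dist_def)
  also have "\<dots> \<le> graph_diameter H"
    unfolding graph_diameter_def using u v pair_finite_verts by (intro Max_ge) auto
  finally show ?thesis .
qed

lemma graph_diameter_le:
  assumes "finite (pverts G)" "pverts G \<noteq> {}"
    and "\<And>u v. u \<in> pverts G \<Longrightarrow> v \<in> pverts G \<Longrightarrow> gdist G u v \<le> D"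
  shows "graph_diameter G \<le> D"
  unfolding graph_diameter_def using assms by (subst Max_le_iff) auto

section \<open>Degrees in star products\<close>

lemma star_product_eq_multi_star_product:
  "star_product G1 E \<phi> G2 = multi_star_product 1 G1 E (\<lambda>u w _. \<phi> u w) G2"
  by (simp add: star_product_def multi_star_product_def)

lemma pair_graphI:
  assumes "finite (pverts G)" "parcs G \<subseteq> pverts G \<times> pverts G"
    and "\<And>u v. (u, v) \<in> parcs G \<Longrightarrow> u \<noteq> v" "\<And>u v. (u, v) \<in> parcs G \<Longrightarrow> (v, u) \<in> parcs G"
  shows "pair_graph G"
proof
  show "finite (parcs G)" using assms(1,2) by (meson finite_SigmaI finite_subset)
  show "symmetric (with_proj G)" using assms(4) by (auto simp: symmetric_def intro: symI)
qed (use assms in auto)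

lemma pair_graph_multi_star_product:
  assumes "pair_graph G1" "pair_graph G2" "orientation G1 E"
  shows "pair_graph (multi_star_product m G1 E \<psi> G2)"
proof -
  interpret G1: pair_graph G1 by fact
  interpret G2: pair_graph G2 by fact
  have "u \<noteq> w" if "(u, w) \<in> E" for u w
    using that assms(3) G1.no_loops' by (auto simp: orientation_def)
  moreover have "(v, v) \<notin> parcs G2" for v
    using G2.no_loops' by blast
  moreover have "(x, v) \<in> parcs G2" if "(v, x) \<in> parcs G2" for v x
    using that by (rule pair_graph_arcs_sym[OF assms(2)])
  ultimately show ?thesis
    using G1.pair_finite_verts G2.pair_finite_verts
    by (intro pair_graphI) (auto simp: multi_star_product_def)
qed

text \<open>
  Over a neighbour \<open>w\<close> of \<open>u\<close> the vertex \<open>(u, v)\<close> has the neighbours \<open>(w, x)\<close> where \<open>x\<close> is the image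
  or the preimage of \<open>v\<close> under one of the bijections on the edge, depending on its orientation.  The
  preimages are \<open>m\<close> different ones too: if two of the bijections mapped the same \<open>x\<close> to \<open>v\<close>, they
  would agree at \<open>x\<close>.
\<close>

lemma out_degree_multi_star_product:
  assumes G1: "pair_graph G1" and G2: "pair_graph G2" and E: "orientation G1 E"
    and bij: "\<And>u w l. (u, w) \<in> E \<Longrightarrow> l < m \<Longrightarrow> bij_betw (\<psi> u w l) (pverts G2) (pverts G2)"
    and distinct: "\<And>u w v. (u, w) \<in> E \<Longrightarrow> v \<in> pverts G2 \<Longrightarrow> inj_on (\<lambda>l. \<psi> u w l v) {..<m}"
    and u: "u \<in> pverts G1" and v: "v \<in> pverts G2"
  shows "out_degree (with_proj (multi_star_product m G1 E \<psi> G2)) (u, v)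
    = m * out_degree (with_proj G1) u + out_degree (with_proj G2) v"
proof -
  interpret G1: pair_graph G1 by fact
  interpret G2: pair_graph G2 by fact
  define inv\<psi> where "inv\<psi> w l = inv_into (pverts G2) (\<psi> w u l)" for w l
  define M where "M w = (if (u, w) \<in> E then (\<lambda>l. \<psi> u w l v) ` {..<m}
    else (\<lambda>l. inv\<psi> w l v) ` {..<m})" for w
  have arcs: "(u', w) \<in> parcs G1 \<and> (w, u') \<notin> E" if "(u', w) \<in> E" for u' w
    using that E by (auto simp: orientation_def)
  have oriented: "(w, u) \<in> E" if "w \<in> parcs G1 `` {u}" "(u, w) \<notin> E" for w
    using that E by (auto simp: orientation_def)
  have inv: "inv\<psi> w l v \<in> pverts G2 \<and> \<psi> w u l (inv\<psi> w l v) = v" if "(w, u) \<in> E" "l < m" for w l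
    using bij[OF that] v unfolding inv\<psi>_def
    by (metis bij_betw_imp_surj_on f_inv_into_f inv_into_into)
  have inv_eq: "x = inv\<psi> w l v"
    if "(w, u) \<in> E" "l < m" "x \<in> pverts G2" "v = \<psi> w u l x" for w l x
    using bij[OF that(1,2)] that(3,4) unfolding inv\<psi>_def
    by (simp add: bij_betw_inv_into_left)
  have sym1: "(w, u') \<in> parcs G1" if "(u', w) \<in> parcs G1" for u' w
    using that by (rule pair_graph_arcs_sym[OF G1])
  have card_M: "card (M w) = m" if w: "w \<in> parcs G1 `` {u}" for w
  proof (cases "(u, w) \<in> E")
    case True
    then show ?thesis using distinct[OF True v] by (simp add: M_def card_image)
  next
    case False
    note wu = oriented[OF w False]
    have "inj_on (\<lambda>l. inv\<psi> w l v) {..<m}"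
    proof (rule inj_onI)
      fix l l' assume l: "l \<in> {..<m}" "l' \<in> {..<m}" and eq: "inv\<psi> w l v = inv\<psi> w l' v"
      let ?x = "inv\<psi> w l v"
      have "\<psi> w u l ?x = \<psi> w u l' ?x" "?x \<in> pverts G2"
        using inv[OF wu, of l] inv[OF wu, of l'] l eq by auto
      with distinct[OF wu] l show "l = l'" by (auto dest: inj_onD)
    qed
    then show ?thesis using False by (simp add: M_def card_image)
  qed
  have "parcs (multi_star_product m G1 E \<psi> G2) `` {(u, v)}
      = {u} \<times> (parcs G2 `` {v}) \<union> Sigma (parcs G1 `` {u}) M" (is "?N = ?A \<union> ?B")
  proof (intro set_eqI)
    fix p :: "'a \<times> 'b"
    obtain w x where p: "p = (w, x)" by (cases p)
    have "(w, x) \<in> ?B \<longleftrightarrow> w \<in> pverts G1 \<and> x \<in> pverts G2 \<and>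
      ((\<exists>l<m. (u, w) \<in> E \<and> x = \<psi> u w l v) \<or> (\<exists>l<m. (w, u) \<in> E \<and> v = \<psi> w u l x))"
    proof
      assume "(w, x) \<in> ?B"
      then have uw: "(u, w) \<in> parcs G1" and x: "x \<in> M w" by auto
      have "w \<in> pverts G1" using G1.in_arcsD2[OF uw] .
      show "w \<in> pverts G1 \<and> x \<in> pverts G2 \<and>
        ((\<exists>l<m. (u, w) \<in> E \<and> x = \<psi> u w l v) \<or> (\<exists>l<m. (w, u) \<in> E \<and> v = \<psi> w u l x))"
      proof (cases "(u, w) \<in> E")
        case True
        with x obtain l where "l < m" "x = \<psi> u w l v" by (auto simp: M_def)
        with True bij[OF True \<open>l < m\<close>] v \<open>w \<in> pverts G1\<close> show ?thesis
          by (auto dest: bij_betwE)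
      next
        case False
        with x obtain l where l: "l < m" "x = inv\<psi> w l v" by (auto simp: M_def)
        have "(w, u) \<in> E" using oriented uw False by auto
        with inv[OF this l(1)] l \<open>w \<in> pverts G1\<close> show ?thesis by auto
      qed
    next
      assume "w \<in> pverts G1 \<and> x \<in> pverts G2 \<and>
        ((\<exists>l<m. (u, w) \<in> E \<and> x = \<psi> u w l v) \<or> (\<exists>l<m. (w, u) \<in> E \<and> v = \<psi> w u l x))"
      then show "(w, x) \<in> ?B"
        using arcs inv_eq[of w] sym1 by (fastforce simp: M_def)
    qed
    moreover have "(w, x) \<in> ?A \<longleftrightarrow> u = w \<and> (v, x) \<in> parcs G2" by auto
    moreover have "(w, x) \<in> ?N \<longleftrightarrow> w \<in> pverts G1 \<and> x \<in> pverts G2 \<and>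
      (u = w \<and> (v, x) \<in> parcs G2 \<or> (\<exists>l<m. (u, w) \<in> E \<and> x = \<psi> u w l v)
        \<or> (\<exists>l<m. (w, u) \<in> E \<and> v = \<psi> w u l x))"
      using u v by (auto simp: multi_star_product_def)
    ultimately show "p \<in> ?N \<longleftrightarrow> p \<in> ?A \<union> ?B"
      using u unfolding p by (auto dest: G2.in_arcsD2)
  qed
  moreover have "?A \<inter> ?B = {}" using G1.no_loops' by auto
  moreover have fin: "finite (parcs G1 `` {u})" "finite (parcs G2 `` {v})"
    using G1.pair_finite_arcs G2.pair_finite_arcs by (auto simp: finite_Image)
  moreover have "finite (M w)" for w by (simp add: M_def)
  ultimately have "card ?N = card (parcs G2 `` {v}) + (\<Sum>w\<in>parcs G1 `` {u}. card (M w))"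
    by (simp add: card_Un_disjoint card_SigmaI)
  also have "(\<Sum>w\<in>parcs G1 `` {u}. card (M w)) = (\<Sum>w\<in>parcs G1 `` {u}. m)"
    by (intro sum.cong refl card_M)
  finally show ?thesis
    by (simp add: out_degree_eq_card_neighbours mult.commute)
qed

section \<open>Order and degree of the construction\<close>

lemma pair_graph_K: "pair_graph (K n)"
  by (rule pair_graphI) (auto simp: K_def)

lemma pair_graph_G8: "pair_graph G8"
proof (rule pair_graphI)
  show "finite (pverts G8)" by (simp add: G8_def V8_def)
qed (auto simp: G8_def)

lemma pair_graph_Kb_G8: "pair_graph (Kb_G8 b)"
  unfolding Kb_G8_def star_product_eq_multi_star_product
  by (intro pair_graph_multi_star_product pair_graph_K pair_graph_G8 orientation_K_arrows)

lemma pair_graph_Ka_Kb_G8: "pair_graph (Ka_Kb_G8 a b)"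
  unfolding Ka_Kb_G8_def
  by (intro pair_graph_multi_star_product pair_graph_K pair_graph_Kb_G8 orientation_K_arrows)

lemma pverts_K: "pverts (K n) = {0..<n}"
  by (simp add: K_def)

lemma pverts_G8: "pverts G8 = V8"
  by (simp add: G8_def)

lemma pverts_Kb_G8: "pverts (Kb_G8 b) = {0..<b} \<times> V8"
  by (simp add: Kb_G8_def star_product_def pverts_K pverts_G8)

lemma pverts_Ka_Kb_G8: "pverts (Ka_Kb_G8 a b) = {0..<a} \<times> {0..<b} \<times> V8"
  by (simp add: Ka_Kb_G8_def multi_star_product_def pverts_K pverts_Kb_G8)

lemma graph_order_Ka_Kb_G8: "graph_order (Ka_Kb_G8 a b) = 8 * a * b"
  by (simp add: graph_order_def pverts_Ka_Kb_G8 V8_def)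

lemma out_degree_K: "u < n \<Longrightarrow> out_degree (with_proj (K n)) u = n - 1"
proof -
  assume "u < n"
  then have "parcs (K n) `` {u} = {0..<n} - {u}" by (auto simp: K_def)
  with \<open>u < n\<close> show ?thesis by (simp add: out_degree_eq_card_neighbours)
qed

lemma finite_V8: "finite V8"
  by (simp add: V8_def)

lemma out_degree_G8:
  assumes "v \<in> V8"
  shows "out_degree (with_proj G8) v = 3"
proof -
  have "parcs G8 `` {v} = {w \<in> V8. (v, w) \<in> parcs G8}"
    by (auto simp: G8_def)
  then have "card (parcs G8 `` {v}) = (\<Sum>w\<in>V8. if (v, w) \<in> parcs G8 then 1 else 0)"
    by (simp add: sum.If_cases Int_def finite_V8)
  moreover have "\<forall>v\<in>V8. (\<Sum>w\<in>V8. if (v, w) \<in> parcs G8 then 1 else 0) = (3::nat)"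
    by (simp add: G8_def V8_def)
  ultimately show ?thesis
    using assms by (simp add: out_degree_eq_card_neighbours)
qed

lemma sigma_pointwise_inj:
  assumes "v \<in> V8"
  shows "inj_on (\<lambda>n. sigma n v) {..<4}"
proof -
  have "\<forall>v\<in>V8. inj_on (\<lambda>n. sigma n v) {0, 1, 2, 3}"
    by (simp add: V8_def sigma_def sigma_tables_def)
  moreover have "{..<4} = {0, 1, 2, 3 :: nat}" by auto
  ultimately show ?thesis using assms by simp
qed

lemma out_degree_Kb_G8:
  assumes "k < b" "v \<in> V8"
  shows "out_degree (with_proj (Kb_G8 b)) (k, v) = b + 2"
proof -
  have "out_degree (with_proj (Kb_G8 b)) (k, v)
      = 1 * out_degree (with_proj (K b)) k + out_degree (with_proj G8) v"
    unfolding Kb_G8_def star_product_eq_multi_star_product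
    by (rule out_degree_multi_star_product)
      (use assms bij_betw_phi8 in \<open>simp_all add: pair_graph_K pair_graph_G8 orientation_K_arrows
        pverts_K pverts_G8 inj_on_def\<close>)
  then show ?thesis using assms by (simp add: out_degree_K out_degree_G8)
qed

lemma out_degree_Ka_Kb_G8:
  assumes "p \<in> pverts (Ka_Kb_G8 a b)"
  shows "out_degree (with_proj (Ka_Kb_G8 a b)) p = 4 * a + b - 2"
proof -
  obtain l k v where p: "p = (l, (k, v))" and lkv: "l < a" "k < b" "v \<in> V8"
    using assms by (auto simp: pverts_Ka_Kb_G8)
  have "out_degree (with_proj (Ka_Kb_G8 a b)) (l, (k, v))
      = 4 * out_degree (with_proj (K a)) l + out_degree (with_proj (Kb_G8 b)) (k, v)"
    unfolding Ka_Kb_G8_def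
  proof (rule out_degree_multi_star_product)
    fix q assume "q \<in> pverts (Kb_G8 b)"
    then show "inj_on (\<lambda>n. (\<lambda>(k, v). (k, sigma n v)) q) {..<4}"
      using sigma_pointwise_inj by (auto simp: pverts_Kb_G8 inj_on_def)
  qed (use lkv in \<open>simp_all add: bij_betw_psi pair_graph_K pair_graph_Kb_G8 orientation_K_arrows
        pverts_K pverts_Kb_G8[symmetric]\<close>, simp add: pverts_Kb_G8)
  then show ?thesis using lkv by (simp add: p out_degree_K out_degree_Kb_G8)
qed

section \<open>The diameter of the construction\<close>

lemma phi8_V8: "v \<in> V8 \<Longrightarrow> phi8 v \<in> V8"
  by (auto simp: V8_def)

lemma phi8_involution: "v \<in> V8 \<Longrightarrow> phi8 (phi8 v) = v"
  by (auto simp: V8_def)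

lemma sigma_V8: "v \<in> V8 \<Longrightarrow> n < 4 \<Longrightarrow> sigma n v \<in> V8"
  using bij_betw_sigma[of n] by (auto simp: G8_def dest: bij_betwE)

lemma parcs_Kb_G8_iff:
  "((k, v), (k', v')) \<in> parcs (Kb_G8 b) \<longleftrightarrow>
    k < b \<and> k' < b \<and> v \<in> V8 \<and> v' \<in> V8 \<and>
    (k = k' \<and> (v, v') \<in> parcs G8 \<or> k \<noteq> k' \<and> v' = phi8 v)"
proof -
  have "v = phi8 v' \<longleftrightarrow> v' = phi8 v" if "v \<in> V8" "v' \<in> V8"
    using that phi8_involution by metis
  then show ?thesis
    by (cases k k' rule: linorder_cases)
      (simp_all add: Kb_G8_def star_product_def pverts_K pverts_G8 K_arrows_def conj_ac cong: conj_cong)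
qed

lemma parcs_Ka_Kb_G8_iff:
  "((l, k, v), (l', k', v')) \<in> parcs (Ka_Kb_G8 a b) \<longleftrightarrow>
    l < a \<and> l' < a \<and> k < b \<and> k' < b \<and> v \<in> V8 \<and> v' \<in> V8 \<and>
    (l = l' \<and> k = k' \<and> (v, v') \<in> parcs G8
     \<or> l = l' \<and> k \<noteq> k' \<and> v' = phi8 v
     \<or> l < l' \<and> k = k' \<and> (\<exists>n<4. v' = sigma n v)
     \<or> l' < l \<and> k = k' \<and> (\<exists>n<4. v = sigma n v'))"
  by (cases l l' rule: linorder_cases)
    (auto simp add: Ka_Kb_G8_def multi_star_product_def pverts_K pverts_Kb_G8 parcs_Kb_G8_iff
      K_arrows_def simp del: phi8.simps)

lemma ex_less_4: "(\<exists>n<4. P n) \<longleftrightarrow> P (0::nat) \<or> P 1 \<or> P 2 \<or> P 3"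
  by (auto simp: less_Suc_eq numeral_eq_Suc)

lemma G8_diameter_2:
  "\<forall>v\<in>V8. \<forall>w\<in>V8.
    v = w \<or> (v, w) \<in> parcs G8 \<or> (\<exists>x\<in>V8. (v, x) \<in> parcs G8 \<and> (x, w) \<in> parcs G8)"
  by (simp add: V8_def G8_def)

lemma phi8_covers_V8:
  "\<forall>v\<in>V8. \<forall>w\<in>V8. v = w \<or> phi8 v = w \<or> (phi8 v, w) \<in> parcs G8
    \<or> (\<exists>x\<in>V8. (v, x) \<in> parcs G8 \<and> phi8 x = w)"
  by (simp add: V8_def G8_def)

lemma sigma_covers_V8:
  "\<forall>v\<in>V8. \<forall>w\<in>V8. \<exists>n<4. sigma n v = w \<or> (sigma n v, w) \<in> parcs G8
    \<or> (\<exists>x\<in>V8. (v, x) \<in> parcs G8 \<and> sigma n x = w)"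
  by (simp add: ex_less_4 V8_def G8_def sigma_def sigma_tables_def)

text \<open>
  The tightest of the four conditions: two vertices that differ in both outer coordinates are to be
  joined by one step along \<open>phi8\<close> and one along some \<open>sigma n\<close>, in either order.  These are eight
  paths from a given vertex, so their end points have to exhaust \<open>V8\<close> without repetition.
\<close>

lemma phi8_sigma_cover_V8:
  "\<forall>v\<in>V8. \<forall>w\<in>V8. \<exists>n<4. sigma n (phi8 v) = w \<or> phi8 (sigma n v) = w"
  by (simp add: ex_less_4 V8_def sigma_def sigma_tables_def)

text \<open>
  A path of length at most 2 can be reversed, so the first coordinate may be assumed not to
  decrease, and then only the permutations \<open>sigma n\<close> themselves occur, not their inverses.
\<close>

lemma gdist_Ka_Kb_G8_le_2:
  assumes b: "3 \<le> b" and p: "p \<in> pverts (Ka_Kb_G8 a b)" and q: "q \<in> pverts (Ka_Kb_G8 a b)"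
  shows "gdist (Ka_Kb_G8 a b) p q \<le> 2"
proof -
  let ?A = "parcs (Ka_Kb_G8 a b)"
  have sym: "(y, x) \<in> ?A" if "(x, y) \<in> ?A" for x y
    using that by (rule pair_graph_arcs_sym[OF pair_graph_Ka_Kb_G8])
  have ordered: "p = q \<or> (p, q) \<in> ?A \<or> (\<exists>r. (p, r) \<in> ?A \<and> (r, q) \<in> ?A)"
    if p: "p \<in> pverts (Ka_Kb_G8 a b)" and q: "q \<in> pverts (Ka_Kb_G8 a b)"
      and le: "fst p \<le> fst q" for p q
  proof -
    obtain l k v where p_eq: "p = (l, k, v)" by (cases p)
    obtain l' k' w where q_eq: "q = (l', k', w)" by (cases q)
    have in_range: "l < a" "k < b" "v \<in> V8" "l' < a" "k' < b" "w \<in> V8" "l \<le> l'"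
      using p q le by (auto simp: p_eq q_eq pverts_Ka_Kb_G8)
    note arc_simps = p_eq q_eq parcs_Ka_Kb_G8_iff
    consider "l = l'" "k = k'" | "l = l'" "k \<noteq> k'" | "l < l'" "k = k'" | "l < l'" "k \<noteq> k'"
      using in_range by linarith
    then show ?thesis
    proof cases
      case 1
      consider "v = w" | "(v, w) \<in> parcs G8"
        | x where "x \<in> V8" "(v, x) \<in> parcs G8" "(x, w) \<in> parcs G8"
        using G8_diameter_2 in_range by blast
      then show ?thesis
      proof cases
        case 3
        then have "(p, (l, k, x)) \<in> ?A" "((l, k, x), q) \<in> ?A"
          using 1 in_range by (simp_all add: arc_simps)
        then show ?thesis by blast
      qed (use 1 in_range in \<open>simp_all add: arc_simps\<close>)
    next
      case 2
      consider "v = w" | "w = phi8 v" | "(phi8 v, w) \<in> parcs G8"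
        | x where "x \<in> V8" "(v, x) \<in> parcs G8" "w = phi8 x"
        using phi8_covers_V8 in_range by blast
      then show ?thesis
      proof cases
        case 1
        \<comment> \<open>the detour leads through a third copy of \<open>G8\<close> with the same first coordinate\<close>
        have "\<exists>k''<3. k'' \<noteq> k \<and> k'' \<noteq> k'"
          by presburger
        then obtain k'' where "k'' < b" "k'' \<noteq> k" "k'' \<noteq> k'"
          using b by (meson less_le_trans)
        then have "(p, (l, k'', phi8 v)) \<in> ?A" "((l, k'', phi8 v), q) \<in> ?A"
          using 1 2 in_range by (simp_all add: arc_simps phi8_V8 phi8_involution)
        then show ?thesis by blast
      next
        case 3
        then have "(p, (l, k', phi8 v)) \<in> ?A" "((l, k', phi8 v), q) \<in> ?A"
          using 2 in_range by (simp_all add: arc_simps phi8_V8)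
        then show ?thesis by blast
      next
        case 4
        then have "(p, (l, k, x)) \<in> ?A" "((l, k, x), q) \<in> ?A"
          using 2 in_range by (simp_all add: arc_simps)
        then show ?thesis by blast
      qed (use 2 in_range in \<open>simp_all add: arc_simps\<close>)
    next
      case 3
      obtain n where n: "n < 4" and "sigma n v = w \<or> (sigma n v, w) \<in> parcs G8
        \<or> (\<exists>x\<in>V8. (v, x) \<in> parcs G8 \<and> sigma n x = w)"
        using sigma_covers_V8 in_range by blast
      then consider "w = sigma n v" | "(sigma n v, w) \<in> parcs G8"
        | x where "x \<in> V8" "(v, x) \<in> parcs G8" "w = sigma n x"
        by blast
      then show ?thesis
      proof cases
        case 1
        then have "(p, q) \<in> ?A" using 3 n in_range by (auto simp: arc_simps)
        then show ?thesis by blast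
      next
        case 2
        then have "(p, (l', k, sigma n v)) \<in> ?A" "((l', k, sigma n v), q) \<in> ?A"
          using 3 n in_range by (auto simp: arc_simps sigma_V8)
        then show ?thesis by blast
      next
        case x: 3
        then have "(p, (l, k, x)) \<in> ?A" "((l, k, x), q) \<in> ?A"
          using 3 n in_range by (auto simp: arc_simps)
        then show ?thesis by blast
      qed
    next
      case 4
      obtain n where n: "n < 4" and "w = sigma n (phi8 v) \<or> w = phi8 (sigma n v)"
        using bspec[OF bspec[OF phi8_sigma_cover_V8 in_range(3)] in_range(6)] by metis
      then show ?thesis
      proof (elim disjE)
        assume "w = sigma n (phi8 v)"
        then have "(p, (l, k', phi8 v)) \<in> ?A" "((l, k', phi8 v), q) \<in> ?A"
          using 4 n in_range by (auto simp: arc_simps phi8_V8)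
        then show ?thesis by blast
      next
        assume "w = phi8 (sigma n v)"
        then have "(p, (l', k, sigma n v)) \<in> ?A" "((l', k, sigma n v), q) \<in> ?A"
          using 4 n in_range by (auto simp: arc_simps sigma_V8)
        then show ?thesis by blast
      qed
    qed
  qed
  have "p = q \<or> (p, q) \<in> ?A \<or> (\<exists>r. (p, r) \<in> ?A \<and> (r, q) \<in> ?A)"
    using linear[of "fst p" "fst q"] ordered[OF p q] ordered[OF q p] sym by blast
  then show ?thesis
  proof (elim disjE exE conjE)
    assume "p = q"
    then show ?thesis using gdist_self[OF pair_graph_Ka_Kb_G8 q] by simp
  next
    assume "(p, q) \<in> ?A"
    then have "gdist (Ka_Kb_G8 a b) p q \<le> 1" by (rule gdist_le_1[OF pair_graph_Ka_Kb_G8])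
    also have "\<dots> \<le> (2 :: ereal)" by simp
    finally show ?thesis .
  qed (rule gdist_le_2[OF pair_graph_Ka_Kb_G8])
qed

section \<open>Optimality\<close>

theorem mainTheorem2:
  fixes a b :: nat
  assumes "a \<ge> 1" and "b \<ge> 3"
  shows
    "(pair_graph (Ka_Kb_G8 a b)
      \<and> graph_order (Ka_Kb_G8 a b) = 8 * a * b
      \<and> max_degree (Ka_Kb_G8 a b) = 4 * a + b - 2
      \<and> (\<forall>H :: 'v pair_pre_digraph.
            pair_graph H \<and> graph_order H = 8 * a * b \<and> max_degree H = 4 * a + b - 2
              \<longrightarrow> graph_diameter (Ka_Kb_G8 a b) \<le> graph_diameter H)
      \<and> (\<forall>H :: 'v pair_pre_digraph.
            pair_graph H \<and> graph_order H = 8 * a * b \<and> max_degree H = 4 * a + b - 2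
              \<longrightarrow> ASPL (Ka_Kb_G8 a b) \<le> ASPL H))
     \<and> (graph_order (Ka_Kb_G8 4 8) = 256
      \<and> max_degree (Ka_Kb_G8 4 8) = 22
      \<and> graph_diameter (Ka_Kb_G8 4 8) = 2
      \<and> (\<forall>H :: 'v pair_pre_digraph.
            pair_graph H \<and> graph_order H = 256 \<and> max_degree H = 22
              \<longrightarrow> ASPL (Ka_Kb_G8 4 8) \<le> ASPL H))"
proof -
  have size: "4 * a + b - 2 + 1 < 8 * a * b" if "1 \<le> a" "3 \<le> b" for a b :: nat
  proof -
    have "4 * a + b \<le> 4 * a * b + a * b" using that by (intro add_mono) auto
    also have "\<dots> < 8 * a * b" using that by simp
    finally show ?thesis using that by linarith
  qed
  have degree: "max_degree (Ka_Kb_G8 a b) = 4 * a + b - 2" if "1 \<le> a" "3 \<le> b" for a b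
    using that by (intro max_degree_regular out_degree_Ka_Kb_G8)
      (auto simp: pverts_Ka_Kb_G8 V8_def)
  have diam: "graph_diameter (Ka_Kb_G8 a b) = 2" if "1 \<le> a" "3 \<le> b" for a b
  proof (rule antisym)
    show "graph_diameter (Ka_Kb_G8 a b) \<le> 2"
      using that gdist_Ka_Kb_G8_le_2
      by (intro graph_diameter_le) (auto simp: pverts_Ka_Kb_G8 V8_def)
    show "2 \<le> graph_diameter (Ka_Kb_G8 a b)"
      using size[OF that] degree[OF that]
      by (intro graph_diameter_ge_2 pair_graph_Ka_Kb_G8) (simp add: graph_order_Ka_Kb_G8)
  qed
  have diam_min: "graph_diameter (Ka_Kb_G8 a b) \<le> graph_diameter H"
    if "1 \<le> a" "3 \<le> b" "pair_graph H" "graph_order H = 8 * a * b"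
      "max_degree H = 4 * a + b - 2" for a b and H :: "'v pair_pre_digraph"
    using graph_diameter_ge_2[OF that(3)] size[OF that(1,2)] that by (simp add: diam)
  have ASPL_min: "ASPL (Ka_Kb_G8 a b) \<le> ASPL H"
    if "1 \<le> a" "3 \<le> b" "pair_graph H" "graph_order H = 8 * a * b"
      "max_degree H = 4 * a + b - 2" for a b and H :: "'v pair_pre_digraph"
    using size[OF that(1,2)] that gdist_Ka_Kb_G8_le_2[OF that(2)]
    by (intro ASPL_le_of_regular_diameter_2[where d = "4 * a + b - 2"] pair_graph_Ka_Kb_G8
        out_degree_Ka_Kb_G8) (auto simp: graph_order_Ka_Kb_G8)
  show ?thesis
    using assms degree[of a b] diam_min[of a b] ASPL_min[of a b]
      degree[of 4 8] diam[of 4 8] ASPL_min[of 4 8]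
    by (simp add: pair_graph_Ka_Kb_G8 graph_order_Ka_Kb_G8)
qed

end
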